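(* Let $(X,p)$ be a partial metric space such that $p(\xi,\xi)=a$ for all $\xi\in X$, where $a$ is a real constant. Let $\mathcal{I}$ be a non-trivial admissible ideal of $\mathbb{N}$ and let $\{\xi_n\}$ be a sequence in $X$. If $c\in X$ is an $\mathcal{I}$-statistical cluster point of $\{\xi_n\}$, then $\mathcal{I}\text{-}st\text{-}LIM^{r}\xi_n\subset\overline{B^{p}_{r}}(c)$ for every $r>0$.
   Context: A partial metric on a non-empty set $X$ is a function $p:X\times X\to[0,\infty)$ such that for all $x,y,z\in X$: (p1) $0\le p(x,x)\le p(x,y)$; (p2) $x=y$ if and only if $p(x,x)=p(x,y)=p(y,y)$; (p3) $p(x,y)=p(y,x)$; (p4) $p(x,y)\le p(x,z)+p(z,y)-p(z,z)$. Then $(X,p)$ is called a partial metric space. The closed ball with center $x\in X$ and radius $r>0$ is $\overline{B^{p}_{r}}(x)=\{y\in X:p(x,y)\le p(x,x)+r\}$. An ideal of $\mathbb{N}$ is a family $\mathcal{I}\subset 2^{\mathbb{N}}$ containing $\emptyset$, closed under finite unions and under taking subsets; it is non-trivial if $\mathcal{I}\ne 2^{\mathbb{N}}$ and $\mathcal{I}\neq\{\emptyset\}$, and a non-trivial ideal is admissible if $\{n\}\in\mathcal{I}$ for every $n\in\mathbb{N}$. For a real sequence $\{x_n\}$, $\mathcal{I}\text{-}\lim_{n\to\infty} x_n=x$ means that for every $\varepsilon>0$, $\{n\in\mathbb{N}:|x_n-x|\ge\varepsilon\}\in\mathcal{I}$. The $\mathcal{I}$-natural density of $A\subset\mathbb{N}$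 is $d_{\mathcal{I}}(A)=\mathcal{I}\text{-}\lim_{n\to\infty}\frac{1}{n}|\{k\le n:k\in A\}|$, if this $\mathcal{I}$-limit exists. A point $c\in X$ is an $\mathcal{I}$-statistical cluster point of $\{\xi_n\}$ if for every $\varepsilon>0$ the set $\{k\in\mathbb{N}:|p(\xi_k,c)-p(c,c)|<\varepsilon\}$ does not have $\mathcal{I}$-natural density zero, i.e. its $\mathcal{I}$-natural density, if it exists, is different from $0$. A sequence $\{\xi_n\}$ in $X$ is rough $\mathcal{I}$-statistically convergent to $\xi\in X$ of roughness degree $r\ge 0$ if for every $\varepsilon>0$ and $\delta>0$, $\left\{n\in\mathbb{N}:\frac{1}{n}\left|\{k\le n:|p(\xi_k,\xi)-p(\xi,\xi)|\ge r+\varepsilon\}\right|\ge\delta\right\}\in\mathcal{I}$. The set of all such $\xi\in X$ is the rough $\mathcal{I}$-statistical limit set, denoted $\mathcal{I}\text{-}st\text{-}LIM^{r}\xi_n$. *)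

theory Defs
  imports Complex_Main
begin

(* The natural numbers of the source start at 1: an ideal of N is a family of subsets of
   {1..}, and a sequence only matters at indices n \<ge> 1.  The value of a sequence at 0 is
   never used. *)
abbreviation posnat :: "nat set" where
  "posnat \<equiv> {1..}"

definition partial_metric_on :: "'a set \<Rightarrow> ('a \<Rightarrow> 'a \<Rightarrow> real) \<Rightarrow> bool" where
  "partial_metric_on X p \<longleftrightarrow>
     X \<noteq> {} \<and>
     (\<forall>x\<in>X. \<forall>y\<in>X. 0 \<le> p x x \<and> p x x \<le> p x y) \<and>
     (\<forall>x\<in>X. \<forall>y\<in>X. x = y \<longleftrightarrow> p x x = p x y \<and> p x y = p y y) \<and>
     (\<forall>x\<in>X. \<forall>y\<in>X. p x y = p y x) \<and>
     (\<forall>x\<in>X. \<forall>y\<in>X. \<forall>z\<in>X. p x y \<le> p x z + p z y - p z z)"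

definition pcball :: "'a set \<Rightarrow> ('a \<Rightarrow> 'a \<Rightarrow> real) \<Rightarrow> 'a \<Rightarrow> real \<Rightarrow> 'a set" where
  "pcball X p x r = {y \<in> X. p x y \<le> p x x + r}"

definition nat_ideal :: "nat set set \<Rightarrow> bool" where
  "nat_ideal I \<longleftrightarrow>
     I \<subseteq> Pow posnat \<and> {} \<in> I \<and>
     (\<forall>A\<in>I. \<forall>B\<in>I. A \<union> B \<in> I) \<and>
     (\<forall>A\<in>I. \<forall>B. B \<subseteq> A \<longrightarrow> B \<in> I)"

definition nontrivial_ideal :: "nat set set \<Rightarrow> bool" where
  "nontrivial_ideal I \<longleftrightarrow> nat_ideal I \<and> I \<noteq> Pow posnat \<and> I \<noteq> {{}}"

definition admissible_ideal :: "nat set set \<Rightarrow> bool" where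
  "admissible_ideal I \<longleftrightarrow> nontrivial_ideal I \<and> (\<forall>n\<in>posnat. {n} \<in> I)"

definition ideal_lim :: "nat set set \<Rightarrow> (nat \<Rightarrow> real) \<Rightarrow> real \<Rightarrow> bool" where
  "ideal_lim I x l \<longleftrightarrow> (\<forall>\<epsilon>>0. {n \<in> posnat. \<bar>x n - l\<bar> \<ge> \<epsilon>} \<in> I)"

(* The density is a relation, since the ideal limit defining it need not exist. *)
definition has_ideal_density :: "nat set set \<Rightarrow> nat set \<Rightarrow> real \<Rightarrow> bool" where
  "has_ideal_density I A d \<longleftrightarrow>
     ideal_lim I (\<lambda>n. real (card {k \<in> posnat. k \<le> n \<and> k \<in> A}) / real n) d"

(* A set whose ideal density does not exist counts as not having density zero. *)
definition ideal_stat_cluster_point ::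
  "'a set \<Rightarrow> ('a \<Rightarrow> 'a \<Rightarrow> real) \<Rightarrow> nat set set \<Rightarrow> (nat \<Rightarrow> 'a) \<Rightarrow> 'a \<Rightarrow> bool" where
  "ideal_stat_cluster_point X p I \<xi> c \<longleftrightarrow>
     c \<in> X \<and>
     (\<forall>\<epsilon>>0. \<not> has_ideal_density I {k \<in> posnat. \<bar>p (\<xi> k) c - p c c\<bar> < \<epsilon>} 0)"

definition rough_ideal_stat_conv ::
  "('a \<Rightarrow> 'a \<Rightarrow> real) \<Rightarrow> nat set set \<Rightarrow> real \<Rightarrow> (nat \<Rightarrow> 'a) \<Rightarrow> 'a \<Rightarrow> bool" where
  "rough_ideal_stat_conv p I r \<xi> x \<longleftrightarrow>
     (\<forall>\<epsilon>>0. \<forall>\<delta>>0.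
        {n \<in> posnat.
           real (card {k \<in> posnat. k \<le> n \<and> \<bar>p (\<xi> k) x - p x x\<bar> \<ge> r + \<epsilon>}) / real n \<ge> \<delta>} \<in> I)"

definition rough_ideal_stat_LIM ::
  "'a set \<Rightarrow> ('a \<Rightarrow> 'a \<Rightarrow> real) \<Rightarrow> nat set set \<Rightarrow> real \<Rightarrow> (nat \<Rightarrow> 'a) \<Rightarrow> 'a set" where
  "rough_ideal_stat_LIM X p I r \<xi> = {x \<in> X. rough_ideal_stat_conv p I r \<xi> x}"

end

theory Submission
  imports Defs
begin

text \<open>If \<open>x\<close> is a rough limit with \<open>p c x > a + r\<close>, put \<open>2 \<epsilon> = p c x - a - r\<close>. By the triangle
  inequality through \<open>\<xi> k\<close>, every index \<open>k\<close> at which \<open>\<xi> k\<close> is \<open>\<epsilon>\<close>-close to \<open>c\<close> is one at which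
  \<open>\<xi> k\<close> has distance at least \<open>r + \<epsilon>\<close> from \<open>x\<close>. The latter indices have density zero, so the
  former do too, which no cluster point allows.\<close>

text \<open>Initial proportions are nonnegative and grow with the set, so wherever the proportion of
  \<open>A\<close> reaches \<epsilon>, that of \<open>B\<close> does too; ideals are closed under
  subsets.\<close>

lemma has_ideal_density_zero_mono:
  assumes "nat_ideal I" and "A \<subseteq> B" and B: "has_ideal_density I B 0"
  shows "has_ideal_density I A 0"
  unfolding has_ideal_density_def ideal_lim_def
proof (intro allI impI)
  fix \<epsilon> :: real
  assume "\<epsilon> > 0"
  let ?d = "\<lambda>S n. real (card {k \<in> posnat. k \<le> n \<and> k \<in> S}) / real n"
  have "?d A n \<le> ?d B n" for n
  proof -
    have "finite {k \<in> posnat. k \<le> n \<and> k \<in> B}"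
      by (rule finite_subset[of _ "{..n}"]) auto
    then have "card {k \<in> posnat. k \<le> n \<and> k \<in> A} \<le> card {k \<in> posnat. k \<le> n \<and> k \<in> B}"
      using \<open>A \<subseteq> B\<close> by (intro card_mono) auto
    then show ?thesis
      by (simp add: divide_right_mono)
  qed
  then have "{n \<in> posnat. \<bar>?d A n - 0\<bar> \<ge> \<epsilon>} \<subseteq> {n \<in> posnat. \<bar>?d B n - 0\<bar> \<ge> \<epsilon>}"
    by (auto intro: order_trans)
  moreover have "{n \<in> posnat. \<bar>?d B n - 0\<bar> \<ge> \<epsilon>} \<in> I"
    using B \<open>\<epsilon> > 0\<close> unfolding has_ideal_density_def ideal_lim_def by blast
  ultimately show "{n \<in> posnat. \<bar>?d A n - 0\<bar> \<ge> \<epsilon>} \<in> I"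
    using \<open>nat_ideal I\<close> unfolding nat_ideal_def by blast
qed

text \<open>Proportions are nonnegative, so the absolute value in the ideal limit at 0 disappears
  and \<delta> takes the part of its tolerance.\<close>

lemma rough_ideal_stat_conv_density:
  assumes "rough_ideal_stat_conv p I r \<xi> x" and "\<epsilon> > 0"
  shows "has_ideal_density I {k \<in> posnat. \<bar>p (\<xi> k) x - p x x\<bar> \<ge> r + \<epsilon>} 0"
  using assms
  by (simp add: rough_ideal_stat_conv_def has_ideal_density_def ideal_lim_def conj_ac cong: conj_cong)

theorem theorem3p9:
  fixes X :: "'a set" and p :: "'a \<Rightarrow> 'a \<Rightarrow> real" and a :: real
    and I :: "nat set set" and \<xi> :: "nat \<Rightarrow> 'a" and c :: 'a
  assumes "partial_metric_on X p"
    and "\<forall>x\<in>X. p x x = a"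
    and "admissible_ideal I"
    and "\<forall>n\<in>posnat. \<xi> n \<in> X"
    and "ideal_stat_cluster_point X p I \<xi> c"
  shows "\<forall>r>0. rough_ideal_stat_LIM X p I r \<xi> \<subseteq> pcball X p c r"
proof (intro allI impI subsetI)
  fix r :: real and x
  assume "x \<in> rough_ideal_stat_LIM X p I r \<xi>"
  then have x: "x \<in> X" "rough_ideal_stat_conv p I r \<xi> x"
    by (auto simp: rough_ideal_stat_LIM_def)
  have c: "c \<in> X"
    using assms(5) by (simp add: ideal_stat_cluster_point_def)
  have ideal: "nat_ideal I"
    using assms(3) by (simp add: admissible_ideal_def nontrivial_ideal_def)
  have "p c x \<le> a + r"
  proof (rule ccontr)
    assume far: "\<not> p c x \<le> a + r"
    define \<epsilon> where "\<epsilon> = (p c x - a - r) / 2"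
    have "\<epsilon> > 0"
      using far by (simp add: \<epsilon>_def)
    have "r + \<epsilon> \<le> \<bar>p (\<xi> k) x - p x x\<bar>" if "k \<in> posnat" "\<bar>p (\<xi> k) c - p c c\<bar> < \<epsilon>" for k
    proof -
      have k: "\<xi> k \<in> X"
        using assms(4) that(1) by blast
      then have "p c x \<le> p c (\<xi> k) + p (\<xi> k) x - p (\<xi> k) (\<xi> k)" "p c (\<xi> k) = p (\<xi> k) c"
        using assms(1) x(1) c unfolding partial_metric_on_def by blast+
      \<comment> \<open>Equal self-distances let the term subtracted in the triangle inequality
        stand in for \<open>p x x\<close>.\<close>
      moreover have "p (\<xi> k) (\<xi> k) = a" "p x x = a" "p c c = a"
        using assms(2) k x(1) c by auto
      \<comment> \<open>\<open>p (\<xi> k) x - a \<ge> p c x - p (\<xi> k) c > p c x - a -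
        \<epsilon> = r + \<epsilon>\<close>, as
        \<open>p c x - a = r + 2 * \<epsilon>\<close>.\<close>
      ultimately show ?thesis
        using that(2) unfolding \<epsilon>_def by argo
    qed
    then have "{k \<in> posnat. \<bar>p (\<xi> k) c - p c c\<bar> < \<epsilon>}
        \<subseteq> {k \<in> posnat. \<bar>p (\<xi> k) x - p x x\<bar> \<ge> r + \<epsilon>}"
      by blast
    then have "has_ideal_density I {k \<in> posnat. \<bar>p (\<xi> k) c - p c c\<bar> < \<epsilon>} 0"
      using has_ideal_density_zero_mono[OF ideal] rough_ideal_stat_conv_density[OF x(2) \<open>\<epsilon> > 0\<close>]
      by blast
    with assms(5) \<open>\<epsilon> > 0\<close> show False
      by (simp add: ideal_stat_cluster_point_def)
  qed
  then show "x \<in> pcball X p c r"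
    using x(1) c assms(2) by (simp add: pcball_def)
qed

end
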